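(* Let $\mathcal{V}$ be an $\alpha$-valuation of the complete bipartite graph $K_{a,b}$ with $ab>1$. Then there exists an integer $\ell>1$ such that $\mathcal{V}$ is equivalent to an $\alpha$-valuation $(V^{\sf small},V^{\sf large})$ with the following properties: (1) every element of $V^{\sf small}$ is a multiple of $\ell$; (2) the set $V^{\sf large}$ is a union of runs of $\ell$ consecutive integers each of which ends with a multiple of $\ell$ (i.e., of sets $\{i\ell-\ell+1,\dots,i\ell-1,i\ell\}$).
   Context: For a graph $G$ with $n$ edges, an $\alpha$-valuation is a one-to-one map from the vertices into $\{0,1,\dots,n\}$ such that the absolute differences of the labels of the endpoints of the edges are exactly $\{1,\dots,n\}$, and there is a value $x$ with $0\le x\le n$ such that every edge joins a vertex with label $\le x$ to one with label $>x$. Vertices are identified with labels; $V^{\sf small}$ is the set of labels $\le x$ and $V^{\sf large}$ the set of labels $>x$. For $K_{a,b}$ the labels lie in $\{0,\dots,ab\}$. Define $\Phi_{ab}(z)=ab-z$ on $\{0,\dots,ab\}$. Two $\alpha$-valuations $\mathcal{V}_1,\mathcal{V}_2$ of $K_{a,b}$ are equivalent if $\mathcal{V}_1=\mathcal{V}_2$, or if for every vertex its label in $\mathcal{V}_2$ is obtained by applying $\Phi_{ab}$ to its label in $\mathcal{V}_1$. *)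

theory Defs
  imports Main
begin

text \<open>A graph is given by its vertex set \<open>V\<close> and its set \<open>E\<close> of two-element vertex sets.\<close>

definition complete_bipartite :: "nat \<Rightarrow> nat \<Rightarrow> 'v set \<Rightarrow> 'v set set \<Rightarrow> bool" where
  "complete_bipartite a b V E \<longleftrightarrow>
     (\<exists>A B. finite A \<and> finite B \<and> card A = a \<and> card B = b \<and> A \<inter> B = {} \<and>
        V = A \<union> B \<and> E = {{u, v} | u v. u \<in> A \<and> v \<in> B})"

text \<open>The value \<open>x\<close> of an alpha-valuation is a parameter here because \<open>small_labels\<close> and
  \<open>large_labels\<close> refer to it. If \<open>E\<close> is finite and nonempty it is determined by \<open>f\<close>: it is the
  smaller label on the edge whose label difference is 1.\<close>

definition alpha_valuation_at :: "'v set \<Rightarrow> 'v set set \<Rightarrow> ('v \<Rightarrow> int) \<Rightarrow> int \<Rightarrow> bool" where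
  "alpha_valuation_at V E f x \<longleftrightarrow>
     inj_on f V \<and>
     f ` V \<subseteq> {0..int (card E)} \<and>
     {\<bar>f u - f v\<bar> | u v. {u, v} \<in> E} = {1..int (card E)} \<and>
     0 \<le> x \<and> x \<le> int (card E) \<and>
     (\<forall>e\<in>E. \<exists>u v. e = {u, v} \<and> f u \<le> x \<and> x < f v)"

definition alpha_valuation :: "'v set \<Rightarrow> 'v set set \<Rightarrow> ('v \<Rightarrow> int) \<Rightarrow> bool" where
  "alpha_valuation V E f \<longleftrightarrow> (\<exists>x. alpha_valuation_at V E f x)"

definition small_labels :: "'v set \<Rightarrow> ('v \<Rightarrow> int) \<Rightarrow> int \<Rightarrow> int set" where
  "small_labels V f x = {z \<in> f ` V. z \<le> x}"

definition large_labels :: "'v set \<Rightarrow> ('v \<Rightarrow> int) \<Rightarrow> int \<Rightarrow> int set" where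
  "large_labels V f x = {z \<in> f ` V. x < z}"

definition Phi :: "nat \<Rightarrow> int \<Rightarrow> int" where
  "Phi n z = int n - z"

text \<open>Valuations are compared on \<open>V\<close> only; their values elsewhere are irrelevant.\<close>

definition equivalent_valuations ::
    "nat \<Rightarrow> nat \<Rightarrow> 'v set \<Rightarrow> ('v \<Rightarrow> int) \<Rightarrow> ('v \<Rightarrow> int) \<Rightarrow> bool" where
  "equivalent_valuations a b V f g \<longleftrightarrow>
     (\<forall>v\<in>V. f v = g v) \<or> (\<forall>v\<in>V. g v = Phi (a * b) (f v))"

end

theory Submission
  imports Defs
begin

text \<open>Measure the small labels downwards from \<open>x\<close> and the large labels upwards from \<open>x + 1\<close>.
  The two sets \<open>P\<close> and \<open>Q\<close> of offsets form a direct-sum decomposition of the interval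
  \<open>{..<a * b}\<close>, and \<open>Phi\<close> exchanges them. Since \<open>1\<close> lies in \<open>P\<close> or in \<open>Q\<close>, we may
  assume \<open>1 \<in> Q\<close>. As in de Bruijn's theorem on such decompositions, if \<open>l\<close> is the length
  of the initial run of \<open>Q\<close>, then \<open>P\<close> consists of multiples of \<open>l\<close>, while \<open>Q\<close> contains
  all or nothing of each block \<open>{k * l..<k * l + l}\<close>.\<close>

text \<open>The minimal excludant; unspecified for \<open>UNIV\<close>.\<close>

definition mex :: "nat set \<Rightarrow> nat" where
  "mex A = (LEAST m. m \<notin> A)"

lemma less_mex_imp_mem: "m < mex A \<Longrightarrow> m \<in> A"
  using not_less_Least by (auto simp: mex_def)

lemma mex_notin: "A \<noteq> UNIV \<Longrightarrow> mex A \<notin> A"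
  unfolding mex_def by (rule LeastI_ex) blast

locale interval_decomposition =
  fixes P Q :: "nat set" and n :: nat
  assumes bij_add: "bij_betw (\<lambda>(p, q). p + q) (P \<times> Q) {..<n}"
    and length_pos: "0 < n"
begin

lemma add_less:
  assumes "p \<in> P" "q \<in> Q"
  shows "p + q < n"
  using bij_betwE[OF bij_add] assms by auto

lemma add_unique:
  assumes "p \<in> P" "q \<in> Q" "p' \<in> P" "q' \<in> Q" "p + q = p' + q'"
  shows "p = p' \<and> q = q'"
  using inj_onD[OF bij_betw_imp_inj_on[OF bij_add], of "(p, q)" "(p', q')"] assms by simp

lemma decompose:
  assumes "m < n"
  obtains p q where "p \<in> P" "q \<in> Q" "m = p + q"
proof -
  have "m \<in> (\<lambda>(p, q). p + q) ` (P \<times> Q)"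
    using bij_betw_imp_surj_on[OF bij_add] assms by simp
  then show thesis using that by auto
qed

lemma zero_mem: "0 \<in> P" "0 \<in> Q"
  using decompose[OF length_pos] by auto

lemma mem_both_imp_zero: "m \<in> P \<Longrightarrow> m \<in> Q \<Longrightarrow> m = 0"
  using add_unique[of m 0 0 m] zero_mem by simp

lemma one_mem_either:
  assumes "1 < n"
  shows "1 \<in> P \<or> 1 \<in> Q"
proof -
  obtain p q where "p \<in> P" "q \<in> Q" "1 = p + q"
    using decompose[OF assms] .
  then show ?thesis by (cases p) auto
qed

lemma right_less: "q \<in> Q \<Longrightarrow> q < n"
  using add_less[OF zero_mem(1)] by simp

lemma mex_notin_right: "mex Q \<notin> Q"
  using right_less by (intro mex_notin) blast

lemma mex_pos: "0 < mex Q"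
  using mex_notin_right zero_mem(2) by (metis gr0I)

lemma mex_gt_one:
  assumes "1 \<in> Q"
  shows "1 < mex Q"
  using mex_notin_right mex_pos assms by (metis less_one linorder_neqE_nat not_less_zero)

lemma mex_mem_left:
  assumes "mex Q < n"
  shows "mex Q \<in> P"
proof -
  obtain p q where pq: "p \<in> P" "q \<in> Q" "mex Q = p + q"
    using decompose[OF assms] .
  have "p \<noteq> 0" using pq mex_notin_right by (metis add_0)
  then have "p \<notin> Q" using mem_both_imp_zero pq(1) by blast
  then have "mex Q \<le> p" using less_mex_imp_mem not_less by blast
  then show ?thesis using pq by simp
qed

lemma block_less:
  assumes "q \<in> Q" "mex Q dvd q" "i < mex Q"
  shows "q + i < n"
proof (cases "mex Q < n")
  case True
  then have "mex Q + q < n" using add_less mex_mem_left assms(1) by blast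
  then show ?thesis using assms(3) by simp
next
  case False
  then have "q = 0" using right_less[OF assms(1)] assms(2)
    by (meson dvd_imp_le gr0I le_trans not_le)
  then show ?thesis using less_mex_imp_mem[OF assms(3)] right_less by simp
qed

text \<open>An element \<open>q + i\<close> of \<open>P\<close> with \<open>0 < i\<close> would give \<open>(q + i) + (mex Q - i) = mex Q + q\<close>.\<close>

lemma block_disjoint_left:
  assumes "q \<in> Q" "mex Q dvd q" "i < mex Q" "q + i \<in> P"
  shows "q + i = 0"
proof (rule ccontr)
  assume nonzero: "q + i \<noteq> 0"
  then have notin: "q + i \<notin> Q" using mem_both_imp_zero assms(4) by blast
  then have "q \<noteq> 0" using less_mex_imp_mem[OF assms(3)] by (metis add_0)
  then have "mex Q \<le> q" using assms(2) by (simp add: dvd_imp_le)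
  have "i \<noteq> 0" using notin assms(1) by (metis add_0_right)
  then have complement: "mex Q - i \<in> Q" using mex_pos by (intro less_mex_imp_mem) simp
  have sum: "q + i + (mex Q - i) = mex Q + q" using assms(3) by simp
  then have "mex Q < n" using add_less[OF assms(4) complement] by linarith
  then have "q + i = mex Q"
    using add_unique[OF assms(4) complement mex_mem_left assms(1) sum] by simp
  then show False using \<open>mex Q \<le> q\<close> \<open>i \<noteq> 0\<close> by simp
qed

lemma block_subset_right:
  assumes P_below: "\<And>p. p \<in> P \<Longrightarrow> p < base \<Longrightarrow> mex Q dvd p"
    and Q_below: "\<And>q. mex Q dvd q \<Longrightarrow> q < base \<Longrightarrow> q + i \<in> Q \<Longrightarrow> q \<in> Q"
    and base: "base \<in> Q" "mex Q dvd base" and i: "i < mex Q"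
  shows "base + i \<in> Q"
proof -
  obtain p q where pq: "p \<in> P" "q \<in> Q" "base + i = p + q"
    using decompose[OF block_less[OF base i]] .
  have "p = 0"
  proof (rule ccontr)
    assume "p \<noteq> 0"
    have "p < base"
    proof (rule ccontr)
      assume "\<not> p < base"
      then obtain j where j: "p = base + j" by (metis le_Suc_ex not_less)
      then have "j < mex Q" using pq(3) i by simp
      then show False using block_disjoint_left[OF base] pq(1) j \<open>p \<noteq> 0\<close> by simp
    qed
    then have "mex Q dvd base - p" using P_below pq(1) base(2) by simp
    moreover have "base - p + i = q" using pq(3) \<open>p < base\<close> by simp
    ultimately have "base - p \<in> Q"
      using Q_below pq(2) \<open>p \<noteq> 0\<close> \<open>p < base\<close> by simp
    then show False
      using add_unique[OF pq(1) _ zero_mem(1) base(1), of "base - p"] \<open>p \<noteq> 0\<close> \<open>p < base\<close> by simp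
  qed
  then show ?thesis using pq by simp
qed

lemma block_disjoint_right:
  assumes P_below: "\<And>p. p \<in> P \<Longrightarrow> p < base \<Longrightarrow> mex Q dvd p"
    and Q_below: "\<And>q. mex Q dvd q \<Longrightarrow> q < base \<Longrightarrow> q \<in> Q \<Longrightarrow> q + i \<in> Q"
    and base: "base \<notin> Q" "mex Q dvd base"
  shows "base + i \<notin> Q" and "base + i \<in> P \<Longrightarrow> i = 0"
proof -
  have shifted: "\<exists>p q. p \<in> P \<and> p \<noteq> 0 \<and> q + i \<in> Q \<and> base = p + q" if "base < n"
  proof -
    obtain p q where pq: "p \<in> P" "q \<in> Q" "base = p + q"
      using decompose[OF \<open>base < n\<close>] .
    have "p \<noteq> 0" using pq base(1) by (metis add_0)
    have "mex Q dvd p" using P_below[OF pq(1)] pq(3) base(2) by (cases "q = 0") auto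
    then have "mex Q dvd q" using base(2) pq(3) by (metis dvd_add_right_iff)
    then have "q + i \<in> Q" using Q_below pq(2,3) \<open>p \<noteq> 0\<close> by simp
    then show ?thesis using pq \<open>p \<noteq> 0\<close> by blast
  qed
  show "base + i \<notin> Q"
  proof
    assume mem: "base + i \<in> Q"
    then obtain p q where "p \<in> P" "p \<noteq> 0" "q + i \<in> Q" "base = p + q"
      using shifted right_less by fastforce
    then show False using add_unique[OF zero_mem(1) mem, of p "q + i"] by simp
  qed
  show "i = 0" if mem: "base + i \<in> P"
  proof -
    obtain p q where "p \<in> P" "q + i \<in> Q" "base = p + q"
      using shifted add_less[OF mem zero_mem(2)] by fastforce
    then show ?thesis using add_unique[OF mem zero_mem(2), of p "q + i"] by simp
  qed
qed

lemma block_membership: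
  assumes "i < mex Q"
  shows "(k * mex Q + i \<in> P \<longrightarrow> i = 0) \<and> (k * mex Q + i \<in> Q \<longleftrightarrow> k * mex Q \<in> Q)"
  using assms
proof (induction k arbitrary: i rule: less_induct)
  case (less k)
  have P_below: "mex Q dvd p" if "p \<in> P" "p < k * mex Q" for p
    using less.IH[of "p div mex Q" "p mod mex Q"] that mex_pos
    by (auto simp: less_mult_imp_div_less mod_eq_0_iff_dvd)
  have Q_below: "q + i \<in> Q \<longleftrightarrow> q \<in> Q" if "mex Q dvd q" "q < k * mex Q" for q
    using less.IH[OF _ less.prems] that by (auto elim!: dvdE simp: mult.commute[of "mex Q"])
  show ?case
  proof (cases "k * mex Q \<in> Q")
    case True
    then have "k * mex Q + i \<in> Q"
      using block_subset_right[where base = "k * mex Q" and i = i] P_below Q_below less.prems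
      by simp
    moreover have "i = 0" if "k * mex Q + i \<in> P"
      using block_disjoint_left[OF True _ less.prems that] by simp
    ultimately show ?thesis using True by blast
  next
    case False
    then show ?thesis
      using block_disjoint_right[where base = "k * mex Q" and i = i] P_below Q_below by simp
  qed
qed

lemma mex_dvd_left:
  assumes "p \<in> P"
  shows "mex Q dvd p"
  using block_membership[of "p mod mex Q" "p div mex Q"] assms mex_pos by (simp add: mod_eq_0_iff_dvd)

lemma right_eq_Union_blocks:
  "Q = (\<Union>k\<in>{k. k * mex Q \<in> Q}. {k * mex Q..<k * mex Q + mex Q})"
proof (intro equalityI subsetI)
  fix q assume "q \<in> Q"
  then have "q div mex Q * mex Q \<in> Q"
    using block_membership[of "q mod mex Q" "q div mex Q"] mex_pos by simp
  moreover have "q \<in> {q div mex Q * mex Q..<q div mex Q * mex Q + mex Q}"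
    using dividend_less_div_times[OF mex_pos, of q] by (simp add: add.commute)
  ultimately show "q \<in> (\<Union>k\<in>{k. k * mex Q \<in> Q}. {k * mex Q..<k * mex Q + mex Q})" by blast
next
  fix q assume "q \<in> (\<Union>k\<in>{k. k * mex Q \<in> Q}. {k * mex Q..<k * mex Q + mex Q})"
  then obtain k where k: "k * mex Q \<in> Q" "k * mex Q \<le> q" "q < k * mex Q + mex Q" by auto
  then show "q \<in> Q" using block_membership[of "q - k * mex Q" k] by simp
qed

end

definition cross_edges :: "'v set \<Rightarrow> 'v set \<Rightarrow> 'v set set" where
  "cross_edges A B = {{u, v} | u v. u \<in> A \<and> v \<in> B}"

lemma cross_edges_commute: "cross_edges A B = cross_edges B A"
  by (auto simp: cross_edges_def insert_commute)

lemma card_cross_edges: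
  assumes "A \<inter> B = {}"
  shows "card (cross_edges A B) = card A * card B"
proof -
  have "cross_edges A B = (\<lambda>(u, v). {u, v}) ` (A \<times> B)"
    by (auto simp: cross_edges_def)
  moreover have "inj_on (\<lambda>(u, v). {u, v}) (A \<times> B)"
    using assms by (auto simp: inj_on_def doubleton_eq_iff)
  ultimately show ?thesis by (simp add: card_image card_cartesian_product)
qed

lemma complete_bipartite_card_edges:
  assumes "complete_bipartite a b V E"
  shows "card E = a * b"
  using assms card_cross_edges by (auto simp: complete_bipartite_def cross_edges_def[symmetric])

definition small_vertices :: "'v set \<Rightarrow> ('v \<Rightarrow> int) \<Rightarrow> int \<Rightarrow> 'v set" where
  "small_vertices V f x = {v \<in> V. f v \<le> x}"

definition large_vertices :: "'v set \<Rightarrow> ('v \<Rightarrow> int) \<Rightarrow> int \<Rightarrow> 'v set" where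
  "large_vertices V f x = {v \<in> V. x < f v}"

lemma alpha_valuation_at_edge:
  assumes "alpha_valuation_at V E f x" "e \<in> E"
  obtains u v where "e = {u, v}" "f u \<le> x" "x < f v"
  using assms by (auto simp: alpha_valuation_at_def)

lemma complete_bipartite_edges_eq_cross_edges:
  assumes "complete_bipartite a b V E" "0 < a * b" "alpha_valuation_at V E f x"
  shows "E = cross_edges (small_vertices V f x) (large_vertices V f x)"
proof -
  obtain A B where parts: "card A = a" "card B = b" "V = A \<union> B" "E = cross_edges A B"
    using assms(1) by (auto simp: complete_bipartite_def cross_edges_def)
  have "f u \<le> x \<longleftrightarrow> x < f v" if "u \<in> A" "v \<in> B" for u v
  proof -
    have "{u, v} \<in> E" using parts(4) that by (auto simp: cross_edges_def)
    then obtain u' v' where "{u, v} = {u', v'}" "f u' \<le> x" "x < f v'"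
      using alpha_valuation_at_edge[OF assms(3)] by blast
    then show ?thesis by (auto simp: doubleton_eq_iff)
  qed
  moreover have "A \<noteq> {}" "B \<noteq> {}" using parts(1,2) assms(2) by auto
  ultimately consider (A_small) "\<forall>u\<in>A. f u \<le> x" "\<forall>v\<in>B. x < f v"
    | (B_small) "\<forall>u\<in>A. x < f u" "\<forall>v\<in>B. f v \<le> x"
    by (metis all_not_in_conv not_le)
  then show ?thesis
  proof cases
    case A_small
    then have "small_vertices V f x = A" "large_vertices V f x = B"
      using parts(3) by (force simp: small_vertices_def large_vertices_def)+
    then show ?thesis using parts(4) by simp
  next
    case B_small
    then have "small_vertices V f x = B" "large_vertices V f x = A"
      using parts(3) by (force simp: small_vertices_def large_vertices_def)+
    then show ?thesis using parts(4) cross_edges_commute by simp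
  qed
qed

definition small_offsets :: "'v set \<Rightarrow> ('v \<Rightarrow> int) \<Rightarrow> int \<Rightarrow> nat set" where
  "small_offsets V f x = {p. x - int p \<in> f ` V}"

definition large_offsets :: "'v set \<Rightarrow> ('v \<Rightarrow> int) \<Rightarrow> int \<Rightarrow> nat set" where
  "large_offsets V f x = {q. x + 1 + int q \<in> f ` V}"

lemma small_offsets_eq_image: "small_offsets V f x = (\<lambda>v. nat (x - f v)) ` small_vertices V f x"
  by (force simp: small_offsets_def small_vertices_def)

lemma large_offsets_eq_image: "large_offsets V f x = (\<lambda>v. nat (f v - x - 1)) ` large_vertices V f x"
  by (force simp: large_offsets_def large_vertices_def)

lemma card_small_offsets:
  assumes "inj_on f V"
  shows "card (small_offsets V f x) = card (small_vertices V f x)"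
  using assms unfolding small_offsets_eq_image
  by (intro card_image) (auto simp: inj_on_def small_vertices_def)

lemma card_large_offsets:
  assumes "inj_on f V"
  shows "card (large_offsets V f x) = card (large_vertices V f x)"
  using assms unfolding large_offsets_eq_image
  by (intro card_image) (auto simp: inj_on_def large_vertices_def)

lemma small_labels_eq_image: "small_labels V f x = (\<lambda>p. x - int p) ` small_offsets V f x"
proof (intro equalityI subsetI)
  fix z assume "z \<in> small_labels V f x"
  then have "z = x - int (nat (x - z))" "nat (x - z) \<in> small_offsets V f x"
    by (auto simp: small_labels_def small_offsets_def)
  then show "z \<in> (\<lambda>p. x - int p) ` small_offsets V f x" by blast
qed (auto simp: small_labels_def small_offsets_def)

lemma large_labels_eq_image: "large_labels V f x = (\<lambda>q. x + 1 + int q) ` large_offsets V f x"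
proof (intro equalityI subsetI)
  fix z assume "z \<in> large_labels V f x"
  then have "z = x + 1 + int (nat (z - x - 1))" "nat (z - x - 1) \<in> large_offsets V f x"
    by (auto simp: large_labels_def large_offsets_def)
  then show "z \<in> (\<lambda>q. x + 1 + int q) ` large_offsets V f x" by blast
qed (auto simp: large_labels_def large_offsets_def)

lemma image_shift_atLeastLessThan:
  "(\<lambda>q. x + 1 + int q) ` {i..<j} = {x + 1 + int i..x + int j}"
proof -
  have "(\<lambda>q. x + 1 + int q) ` {i..<j} = (+) (x + 1) ` int ` {i..<j}"
    by (simp add: image_image)
  also have "\<dots> = {x + 1 + int i..x + int j}"
    by (simp add: image_int_atLeastLessThan image_add_atLeastLessThan) force
  finally show ?thesis .
qed

lemma edge_differences_eq_offset_sums: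
  assumes "E = cross_edges (small_vertices V f x) (large_vertices V f x)"
  shows "{\<bar>f u - f v\<bar> | u v. {u, v} \<in> E} =
    (\<lambda>m. 1 + int m) ` (\<lambda>(p, q). p + q) ` (small_offsets V f x \<times> large_offsets V f x)"
proof -
  let ?S = "small_vertices V f x" and ?L = "large_vertices V f x"
  have "{u, v} \<in> E \<longleftrightarrow> u \<in> ?S \<and> v \<in> ?L \<or> v \<in> ?S \<and> u \<in> ?L" for u v
    unfolding assms cross_edges_def by (auto simp: doubleton_eq_iff)
  then have "{\<bar>f u - f v\<bar> | u v. {u, v} \<in> E} = (\<lambda>(u, v). \<bar>f u - f v\<bar>) ` (?S \<times> ?L)"
    by (auto simp: image_iff) (metis abs_minus_commute)
  also have "\<dots> = (\<lambda>(u, v). 1 + int (nat (x - f u) + nat (f v - x - 1))) ` (?S \<times> ?L)"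
    by (intro image_cong) (auto simp: small_vertices_def large_vertices_def)
  also have "\<dots> = (\<lambda>m. 1 + int m) ` (\<lambda>(p, q). p + q) `
      map_prod (\<lambda>u. nat (x - f u)) (\<lambda>v. nat (f v - x - 1)) ` (?S \<times> ?L)"
    by (simp only: image_image case_prod_unfold fst_map_prod snd_map_prod)
  also have "map_prod (\<lambda>u. nat (x - f u)) (\<lambda>v. nat (f v - x - 1)) ` (?S \<times> ?L) =
      small_offsets V f x \<times> large_offsets V f x"
    by (simp add: map_prod_surj_on small_offsets_eq_image large_offsets_eq_image)
  finally show ?thesis .
qed

lemma interval_decomposition_offsets:
  assumes valuation: "alpha_valuation_at V E f x"
    and edges: "E = cross_edges (small_vertices V f x) (large_vertices V f x)"
    and pos: "0 < card E"
  shows "interval_decomposition (small_offsets V f x) (large_offsets V f x) (card E)"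
proof
  let ?P = "small_offsets V f x" and ?Q = "large_offsets V f x"
  have "(\<lambda>m. 1 + int m) ` (\<lambda>(p, q). p + q) ` (?P \<times> ?Q) = {1..int (card E)}"
    using valuation edge_differences_eq_offset_sums[OF edges] by (simp add: alpha_valuation_at_def)
  also have "\<dots> = (\<lambda>m. 1 + int m) ` {..<card E}"
    using image_shift_atLeastLessThan[of 0 0 "card E"] by (simp add: lessThan_atLeast0)
  finally have sums: "(\<lambda>(p, q). p + q) ` (?P \<times> ?Q) = {..<card E}"
    by (simp add: inj_image_eq_iff inj_on_def)
  have "card (?P \<times> ?Q) = card (small_vertices V f x) * card (large_vertices V f x)"
    using valuation
    by (simp add: alpha_valuation_at_def card_cartesian_product card_small_offsets card_large_offsets)
  also have "\<dots> = card E"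
    unfolding edges by (subst card_cross_edges) (auto simp: small_vertices_def large_vertices_def)
  finally have "card (?P \<times> ?Q) = card E" .
  moreover from this have "finite (?P \<times> ?Q)" using pos by (intro card_ge_0_finite) simp
  ultimately have "inj_on (\<lambda>(p, q). p + q) (?P \<times> ?Q)"
    using sums by (intro eq_card_imp_inj_on) simp_all
  then show "bij_betw (\<lambda>(p, q). p + q) (?P \<times> ?Q) {..<card E}"
    using sums by (simp add: bij_betw_def)
qed (fact pos)

lemma complete_bipartite_interval_decomposition:
  assumes graph: "complete_bipartite a b V E"
    and pos: "0 < a * b"
    and valuation: "alpha_valuation_at V E f x"
  shows "interval_decomposition (small_offsets V f x) (large_offsets V f x) (card E)"
proof (rule interval_decomposition_offsets[OF valuation])
  show "E = cross_edges (small_vertices V f x) (large_vertices V f x)"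
    by (rule complete_bipartite_edges_eq_cross_edges[OF graph pos valuation])
  show "0 < card E" unfolding complete_bipartite_card_edges[OF graph] by (rule pos)
qed

lemma nat_mem_small_offsets:
  assumes valuation: "alpha_valuation_at V E f x"
    and decomposition: "interval_decomposition (small_offsets V f x) (large_offsets V f x) (card E)"
  shows "nat x \<in> small_offsets V f x"
proof -
  interpret interval_decomposition "small_offsets V f x" "large_offsets V f x" "card E"
    by (fact decomposition)
  have range: "f ` V \<subseteq> {0..int (card E)}" "0 \<le> x"
    using valuation by (simp_all add: alpha_valuation_at_def)
  obtain p q where pq: "p \<in> small_offsets V f x" "q \<in> large_offsets V f x" "card E - 1 = p + q"
    using decompose[of "card E - 1"] length_pos by auto
  then have "0 \<le> x - int p" "x + 1 + int q \<le> int (card E)"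
    using range(1) by (auto simp: small_offsets_def large_offsets_def)
  then have "nat x = p" using pq(3) length_pos by linarith
  then show ?thesis using pq(1) by simp
qed

lemma mex_dvd_threshold:
  assumes valuation: "alpha_valuation_at V E f x"
    and decomposition: "interval_decomposition (small_offsets V f x) (large_offsets V f x) (card E)"
  shows "int (mex (large_offsets V f x)) dvd x"
proof -
  have "mex (large_offsets V f x) dvd nat x"
    using interval_decomposition.mex_dvd_left[OF decomposition] nat_mem_small_offsets[OF assms] .
  then show ?thesis using valuation by (simp add: alpha_valuation_at_def flip: int_dvd_int_iff)
qed

lemma mex_dvd_small_labels:
  assumes valuation: "alpha_valuation_at V E f x"
    and decomposition: "interval_decomposition (small_offsets V f x) (large_offsets V f x) (card E)"
    and "z \<in> small_labels V f x"
  shows "int (mex (large_offsets V f x)) dvd z"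
proof -
  obtain p where "p \<in> small_offsets V f x" "z = x - int p"
    using assms(3) by (auto simp: small_labels_eq_image)
  then show ?thesis
    using interval_decomposition.mex_dvd_left[OF decomposition]
      mex_dvd_threshold[OF valuation decomposition] by simp
qed

lemma large_labels_eq_Union_blocks:
  assumes valuation: "alpha_valuation_at V E f x"
    and decomposition: "interval_decomposition (small_offsets V f x) (large_offsets V f x) (card E)"
    and l: "l = int (mex (large_offsets V f x))"
  shows "\<exists>I. large_labels V f x = (\<Union>i\<in>I. {i * l - l + 1..i * l})"
proof -
  let ?Q = "large_offsets V f x"
  obtain c where c: "x = l * c"
    using mex_dvd_threshold[OF valuation decomposition] l by blast
  define m where "m = mex ?Q"
  have l_eq: "l = int m" by (simp add: l m_def)
  have block: "(\<lambda>q. x + 1 + int q) ` {k * m..<k * m + m} =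
      {(c + int k + 1) * l - l + 1..(c + int k + 1) * l}" for k
    unfolding image_shift_atLeastLessThan c l_eq by (simp add: algebra_simps)
  have "large_labels V f x = (\<lambda>q. x + 1 + int q) ` ?Q"
    by (rule large_labels_eq_image)
  also have "\<dots> = (\<lambda>q. x + 1 + int q) ` (\<Union>k\<in>{k. k * m \<in> ?Q}. {k * m..<k * m + m})"
    unfolding m_def
    by (rule arg_cong[OF interval_decomposition.right_eq_Union_blocks[OF decomposition]])
  also have "\<dots> = (\<Union>i\<in>(\<lambda>k. c + int k + 1) ` {k. k * m \<in> ?Q}. {i * l - l + 1..i * l})"
    by (simp only: image_UN block UN_simps)
  finally show ?thesis by blast
qed

lemma alpha_valuation_at_Phi:
  assumes "alpha_valuation_at V E f x" "x < int (card E)"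
  shows "alpha_valuation_at V E (Phi (card E) \<circ> f) (int (card E) - 1 - x)"
proof -
  have "\<exists>u v. e = {u, v} \<and> Phi (card E) (f u) \<le> int (card E) - 1 - x \<and>
      int (card E) - 1 - x < Phi (card E) (f v)" if "e \<in> E" for e
  proof -
    obtain u v where "e = {u, v}" "f u \<le> x" "x < f v"
      using alpha_valuation_at_edge[OF assms(1) \<open>e \<in> E\<close>] .
    then show ?thesis by (intro exI[of _ v] exI[of _ u]) (auto simp: Phi_def)
  qed
  moreover have "\<bar>Phi (card E) (f u) - Phi (card E) (f v)\<bar> = \<bar>f u - f v\<bar>" for u v
    by (simp add: Phi_def abs_minus_commute)
  moreover have "inj_on (Phi (card E) \<circ> f) V"
    using assms(1) by (auto simp: alpha_valuation_at_def inj_on_def Phi_def)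
  moreover have "(Phi (card E) \<circ> f) ` V \<subseteq> {0..int (card E)}"
    using assms(1) by (fastforce simp: alpha_valuation_at_def Phi_def)
  ultimately show ?thesis using assms unfolding alpha_valuation_at_def by simp
qed

lemma large_offsets_Phi:
  "large_offsets V (Phi n \<circ> f) (int n - 1 - x) = small_offsets V f x"
  by (force simp: large_offsets_def small_offsets_def Phi_def)

lemma equivalent_valuation_one_large_offset:
  assumes graph: "complete_bipartite a b V E"
    and "1 < a * b"
    and valuation: "alpha_valuation_at V E f x"
  obtains g y where "alpha_valuation_at V E g y" "equivalent_valuations a b V f g"
    "1 \<in> large_offsets V g y"
proof -
  have card_E: "card E = a * b" by (rule complete_bipartite_card_edges[OF graph])
  interpret interval_decomposition "small_offsets V f x" "large_offsets V f x" "card E"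
    using complete_bipartite_interval_decomposition[OF graph _ valuation] \<open>1 < a * b\<close>
    by linarith
  consider (large) "1 \<in> large_offsets V f x" | (small) "1 \<in> small_offsets V f x"
    using one_mem_either card_E \<open>1 < a * b\<close> by auto
  then show thesis
  proof cases
    case large
    then show thesis using that[of f x] valuation by (simp add: equivalent_valuations_def)
  next
    case small
    have "x + 1 \<in> f ` V" using zero_mem(2) by (simp add: large_offsets_def)
    then have "x < int (card E)" using valuation by (force simp: alpha_valuation_at_def)
    moreover have "equivalent_valuations a b V f (Phi (card E) \<circ> f)"
      by (simp add: equivalent_valuations_def card_E)
    ultimately show thesis
      using that[OF alpha_valuation_at_Phi[OF valuation]] small by (simp add: large_offsets_Phi)
  qed
qed

theorem theorem2p9:
  fixes a b :: nat and V :: "'v set" and E :: "'v set set" and f :: "'v \<Rightarrow> int"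
  assumes "complete_bipartite a b V E"
    and "a * b > 1"
    and "alpha_valuation V E f"
  shows "\<exists>l::int. l > 1 \<and>
    (\<exists>g x. alpha_valuation_at V E g x \<and>
       equivalent_valuations a b V f g \<and>
       (\<forall>z\<in>small_labels V g x. l dvd z) \<and>
       (\<exists>I::int set. large_labels V g x = (\<Union>i\<in>I. {i * l - l + 1..i * l})))"
proof -
  obtain x where "alpha_valuation_at V E f x"
    using assms(3) by (auto simp: alpha_valuation_def)
  then obtain g y where valuation: "alpha_valuation_at V E g y"
    and equivalent: "equivalent_valuations a b V f g"
    and one: "1 \<in> large_offsets V g y"
    using equivalent_valuation_one_large_offset[OF assms(1,2)] by blast
  have decomposition:
      "interval_decomposition (small_offsets V g y) (large_offsets V g y) (card E)"
    using complete_bipartite_interval_decomposition[OF assms(1) _ valuation] assms(2) by linarith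
  define l where "l = int (mex (large_offsets V g y))"
  have "1 < l" using interval_decomposition.mex_gt_one[OF decomposition one] by (simp add: l_def)
  moreover have "\<forall>z\<in>small_labels V g y. l dvd z"
    using mex_dvd_small_labels[OF valuation decomposition] by (simp add: l_def)
  ultimately show ?thesis
    using large_labels_eq_Union_blocks[OF valuation decomposition l_def] valuation equivalent
    by blast
qed

end
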